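(* Let $N\ge 1$ be an integer, and let $X_0,\dots,X_N$, $U_0,\dots,U_{N-1}$, $W_0,\dots,W_{N-1}$ be Banach spaces with the data $C,\Omega_k,A_k,B_k,T_k,h_k$ of the parametric convex discrete optimal control problem described in the context, with optimal value function $V:W\to[-\infty,+\infty]$ and solution map $S$. Let $\bar w=(\bar w_0,\dots,\bar w_{N-1})\in W$ be such that $V(\bar w)$ is finite, and let $(\bar x,\bar u)\in S(\bar w)$, where $\bar x=(\bar x_0,\dots,\bar x_N)$ and $\bar u=(\bar u_0,\dots,\bar u_{N-1})$. Suppose that $h_k$, $k=0,1,\dots,N$, are continuous and the interiors of $\Omega_k$, $k=0,1,\dots,N-1$, are nonempty, that (i) $\ker T^*\subset\ker M^*$; (ii) the operator $\Phi:W\times Z\to\widetilde X$ defined by $\Phi(w,z)=-Tw+Mz$ has closed range; and, additionally, that the functions $h_k$, $k=0,1,\dots,N$, are Fréchet differentiable. Then a vector $\tilde w^*=(\tilde w_0^*,\dots,\tilde w_{N-1}^* )\in W^*$ belongs to $\partial V(\bar w)$ if and only if there exist $x_0^*\in N(\bar x_0;C)$, $\tilde x^*=(\tilde x_1^*,\dots,\tilde x_N^* )\in\widetilde X^*$ and $u^*=(u_0^*,\dots,u_{N-1}^* )\in N(\bar u;\Omega)$ such that $$\begin{cases} \tilde x_N^*=\nabla h_N(\bar x_N),\\ \tilde x_k^*=\nabla_{x_k}h_k(\bar x_k,\bar u_k,\bar w_k)+A_k^*\tilde x_{k+1}^*, & k=1,2,\dots,N-1,\\ x_0^*=-\nabla_{x_0}h_0(\bar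 x_0,\bar u_0,\bar w_0)-A_0^*\tilde x_1^*,\\ u_k^*=-\nabla_{u_k}h_k(\bar x_k,\bar u_k,\bar w_k)-B_k^*\tilde x_{k+1}^*, & k=0,1,\dots,N-1,\\ \tilde w_k^*=\nabla_{w_k}h_k(\bar x_k,\bar u_k,\bar w_k)+T_k^*\tilde x_{k+1}^*, & k=0,1,\dots,N-1. \end{cases}$$
   Context: All Banach spaces are real. Data: convex sets $\Omega_k\subset U_k$ ($k=0,\dots,N-1$) and $C\subset X_0$; continuous linear operators $A_k:X_k\to X_{k+1}$, $B_k:U_k\to X_{k+1}$, $T_k:W_k\to X_{k+1}$ ($k=0,\dots,N-1$); convex functions $h_k:X_k\times U_k\times W_k\to\mathbb R$ ($k=0,\dots,N-1$) and $h_N:X_N\to\mathbb R$. Notation: $X=X_0\times\cdots\times X_N$, $\widetilde X=X_1\times\cdots\times X_N$, $U=U_0\times\cdots\times U_{N-1}$, $W=W_0\times\cdots\times W_{N-1}$, $Z=X\times U$, $\Omega=\Omega_0\times\cdots\times\Omega_{N-1}$. Control problem: for $w=(w_0,\dots,w_{N-1})\in W$, minimize $\sum_{k=0}^{N-1}h_k(x_k,u_k,w_k)+h_N(x_N)$ over all $(x,u)\in X\times U$ satisfying $x_{k+1}=A_kx_k+B_ku_k+T_kw_k$ and $u_k\in\Omega_k$ for $k=0,\dots,N-1$, and $x_0\in C$. $V(w)$ is the infimum of this problem (the optimal value function), and $S(w)$ is its set of solutions (minimizers) $(x,u)$. Operators: $M:Z\to\widetilde X$ is the continuous linear operator whose component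 in $X_{k+1}$ is $-A_kx_k+x_{k+1}-B_ku_k$ for $z=(x,u)$, $k=0,\dots,N-1$; $T:W\to\widetilde X$ is $Tw=(T_0w_0,\dots,T_{N-1}w_{N-1})$. Stars on operators denote adjoints, stars on spaces denote topological duals, and the dual of a product is identified with the product of the duals. For a convex set $D$ in a Banach space $Y$ and $\bar y\in D$, $N(\bar y;D)=\{y^*\in Y^*\mid\langle y^*,y-\bar y\rangle\le0\ \forall y\in D\}$. For a convex function $\varphi:Y\to[-\infty,+\infty]$ finite at $\bar y$, $\partial\varphi(\bar y)=\{y^*\in Y^*\mid\langle y^*,y-\bar y\rangle\le\varphi(y)-\varphi(\bar y)\ \forall y\in Y\}$. The symbols $\nabla h_N(\bar x_N)$, $\nabla_{x_k}h_k(\bar x_k,\bar u_k,\bar w_k)$, $\nabla_{u_k}h_k(\bar x_k,\bar u_k,\bar w_k)$, $\nabla_{w_k}h_k(\bar x_k,\bar u_k,\bar w_k)$ denote the Fréchet derivatives of $h_N(\cdot)$ at $\bar x_N$, of $h_k(\cdot,\bar u_k,\bar w_k)$ at $\bar x_k$, of $h_k(\bar x_k,\cdot,\bar w_k)$ at $\bar u_k$, and of $h_k(\bar x_k,\bar u_k,\cdot)$ at $\bar w_k$, respectively. *)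

theory Defs
  imports "HOL-Analysis.Analysis"
begin

text \<open>
  The spaces of a family \<open>X\<^sub>0, \<dots>, X\<^sub>N\<close> of Banach spaces may all be different, so they cannot be
  types: the length of the family is a variable. They are rendered as arbitrary closed linear
  subspaces \<open>X k\<close> of one Banach space type, with the inherited norm. This covers every finite family
  of Banach spaces, since such a family embeds isometrically, by closed subspaces, into its direct
  sum. Nothing below refers to points outside the subspaces: topological notions are relative to
  the subspace, functionals and derivatives are those of the subspace, and operators need only be
  defined (linear, continuous) on it.

  A product \<open>X\<^sub>i \<times> \<dots> \<times> X\<^sub>j\<close> is the extensional function space \<^term>\<open>PiE {i..j} X\<close>, and its dual is
  the product of the duals.
\<close>

definition banach_subspace :: "'a::banach set \<Rightarrow> bool" where
  "banach_subspace S \<longleftrightarrow> subspace S \<and> closed S"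

definition linear_between :: "'a::real_vector set \<Rightarrow> 'b::real_vector set \<Rightarrow> ('a \<Rightarrow> 'b) \<Rightarrow> bool" where
  "linear_between S S' L \<longleftrightarrow>
     L \<in> S \<rightarrow> S' \<and>
     (\<forall>x\<in>S. \<forall>y\<in>S. L (x + y) = L x + L y) \<and>
     (\<forall>c. \<forall>x\<in>S. L (c *\<^sub>R x) = c *\<^sub>R L x)"

definition cont_linear_between ::
    "'a::real_normed_vector set \<Rightarrow> 'b::real_normed_vector set \<Rightarrow> ('a \<Rightarrow> 'b) \<Rightarrow> bool" where
  "cont_linear_between S S' L \<longleftrightarrow> linear_between S S' L \<and> continuous_on S L"

text \<open>Functionals on \<open>S\<close> are extensional, so that each has exactly one representative.\<close>

definition cont_dual :: "'a::real_normed_vector set \<Rightarrow> ('a \<Rightarrow> real) set" where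
  "cont_dual S = {f \<in> extensional S. cont_linear_between S UNIV f}"

definition tuple_dual :: "nat set \<Rightarrow> (nat \<Rightarrow> 'a::real_normed_vector set) \<Rightarrow> (nat \<Rightarrow> 'a \<Rightarrow> real) set" where
  "tuple_dual I S = PiE I (\<lambda>k. cont_dual (S k))"

definition pairing :: "nat set \<Rightarrow> (nat \<Rightarrow> 'a \<Rightarrow> real) \<Rightarrow> (nat \<Rightarrow> 'a) \<Rightarrow> real" where
  "pairing I f x = (\<Sum>k\<in>I. f k (x k))"

text \<open>\<open>adjoint_on S L f\<close> is the functional \<open>L\<^sup>* f\<close> on the domain \<open>S\<close> of \<open>L\<close>.\<close>

definition adjoint_on :: "'d set \<Rightarrow> ('d \<Rightarrow> 'b) \<Rightarrow> ('b \<Rightarrow> real) \<Rightarrow> 'd \<Rightarrow> real" where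
  "adjoint_on S L f = (\<lambda>v\<in>S. f (L v))"

text \<open>Kernel of the adjoint of an operator \<open>L\<close> from \<open>D\<close> into the product of the \<open>Y k\<close>, \<open>k \<in> I\<close>.\<close>

definition ker_adjoint ::
    "nat set \<Rightarrow> (nat \<Rightarrow> 'b::real_normed_vector set) \<Rightarrow> 'd set \<Rightarrow> ('d \<Rightarrow> nat \<Rightarrow> 'b) \<Rightarrow>
     (nat \<Rightarrow> 'b \<Rightarrow> real) set" where
  "ker_adjoint I Y D L = {f \<in> tuple_dual I Y. \<forall>d\<in>D. adjoint_on D L (pairing I f) d = 0}"

text \<open>
  The derivative of a function on the normed space \<open>S\<close>. The library relation
  \<^const>\<open>has_derivative\<close> is not used, as it asks for a derivative defined on the whole type, which is
  not determined by the values of the function on \<open>S\<close>.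
\<close>

definition has_frechet_on ::
    "'a::real_normed_vector set \<Rightarrow> ('a \<Rightarrow> real) \<Rightarrow> ('a \<Rightarrow> real) \<Rightarrow> 'a \<Rightarrow> bool" where
  "has_frechet_on S f D x \<longleftrightarrow>
     D \<in> cont_dual S \<and>
     ((\<lambda>y. (f y - f x - D (y - x)) / norm (y - x)) \<longlongrightarrow> 0) (at x within S)"

definition frechet_differentiable_on ::
    "'a::real_normed_vector set \<Rightarrow> ('a \<Rightarrow> real) \<Rightarrow> bool" where
  "frechet_differentiable_on S f \<longleftrightarrow> (\<forall>x\<in>S. \<exists>D. has_frechet_on S f D x)"

definition frechet_deriv_on ::
    "'a::real_normed_vector set \<Rightarrow> ('a \<Rightarrow> real) \<Rightarrow> 'a \<Rightarrow> 'a \<Rightarrow> real" where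
  "frechet_deriv_on S f x = (THE D. has_frechet_on S f D x)"

lemma has_frechet_on_unique:
  assumes S: "subspace S" and x: "x \<in> S"
    and D: "has_frechet_on S f D x" and E: "has_frechet_on S f E x"
  shows "D = E"
proof (rule extensionalityI[of _ S])
  show "D \<in> extensional S" "E \<in> extensional S"
    using D E by (auto simp: has_frechet_on_def cont_dual_def)
next
  fix v assume v: "v \<in> S"
  have lin: "G (c *\<^sub>R u) = c * G u" if "G \<in> {D, E}" "u \<in> S" for G c u
    using that D E
    by (auto simp: has_frechet_on_def cont_dual_def cont_linear_between_def linear_between_def)
  show "D v = E v"
  proof (cases "v = 0")
    case True
    then show ?thesis using lin[of D 0 0] lin[of E 0 0] subspace_0[OF S] by simp
  next
    case False
    have "((\<lambda>y. (f y - f x - D (y - x)) / norm (y - x) - (f y - f x - E (y - x)) / norm (y - x))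
            \<longlongrightarrow> 0 - 0) (at x within S)"
      using D E unfolding has_frechet_on_def by (intro tendsto_diff) auto
    then have lim: "((\<lambda>y. (E (y - x) - D (y - x)) / norm (y - x)) \<longlongrightarrow> 0) (at x within S)"
      by (simp add: diff_divide_distrib[symmetric] algebra_simps)
    have "filterlim (\<lambda>t. x + t *\<^sub>R v) (at x within S) (at_right (0::real))"
    proof -
      have "((\<lambda>t. x + t *\<^sub>R v) \<longlongrightarrow> x + 0 *\<^sub>R v) (at_right (0::real))"
        by (intro tendsto_intros)
      then have a: "((\<lambda>t. x + t *\<^sub>R v) \<longlongrightarrow> x) (at_right (0::real))" by simp
      have "\<forall>\<^sub>F t in at_right (0::real). x + t *\<^sub>R v \<in> S \<and> x + t *\<^sub>R v \<noteq> x"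
        unfolding eventually_at_filter
        using False S x v by (auto simp: subspace_add subspace_mul)
      with a show "filterlim (\<lambda>t. x + t *\<^sub>R v) (at x within S) (at_right 0)"
        by (auto simp: filterlim_at elim: eventually_mono)
    qed
    then have "((\<lambda>t. (E (t *\<^sub>R v) - D (t *\<^sub>R v)) / norm (t *\<^sub>R v)) \<longlongrightarrow> 0) (at_right (0::real))"
      using filterlim_compose[OF lim] by fastforce
    moreover have "\<forall>\<^sub>F t in at_right (0::real).
        (E (t *\<^sub>R v) - D (t *\<^sub>R v)) / norm (t *\<^sub>R v) = (E v - D v) / norm v"
      unfolding eventually_at_filter
      using lin[of D v] lin[of E v] v False by (auto simp: field_simps intro!: always_eventually)
    ultimately have "((\<lambda>t. (E v - D v) / norm v) \<longlongrightarrow> 0) (at_right (0::real))"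
      by (rule Lim_transform_eventually)
    then show ?thesis using False by (simp add: tendsto_const_iff)
  qed
qed

lemma frechet_deriv_on_eqI:
  assumes "subspace S" "x \<in> S" "has_frechet_on S f D x"
  shows "frechet_deriv_on S f x = D"
  unfolding frechet_deriv_on_def using assms has_frechet_on_unique by blast

definition normal_cone :: "'a::real_normed_vector set \<Rightarrow> 'a set \<Rightarrow> 'a \<Rightarrow> ('a \<Rightarrow> real) set" where
  "normal_cone S D y = {f \<in> cont_dual S. \<forall>y'\<in>D. f (y' - y) \<le> 0}"

definition tuple_normal_cone ::
    "nat set \<Rightarrow> (nat \<Rightarrow> 'a::real_normed_vector set) \<Rightarrow> (nat \<Rightarrow> 'a) set \<Rightarrow> (nat \<Rightarrow> 'a) \<Rightarrow>
     (nat \<Rightarrow> 'a \<Rightarrow> real) set" where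
  "tuple_normal_cone I S D y =
     {f \<in> tuple_dual I S. \<forall>y'\<in>D. pairing I f (\<lambda>k\<in>I. y' k - y k) \<le> 0}"

definition tuple_subdifferential ::
    "nat set \<Rightarrow> (nat \<Rightarrow> 'a::real_normed_vector set) \<Rightarrow> ((nat \<Rightarrow> 'a) \<Rightarrow> ereal) \<Rightarrow> (nat \<Rightarrow> 'a) \<Rightarrow>
     (nat \<Rightarrow> 'a \<Rightarrow> real) set" where
  "tuple_subdifferential I S \<phi> y =
     {f \<in> tuple_dual I S. \<forall>y'\<in>PiE I S. ereal (pairing I f (\<lambda>k\<in>I. y' k - y k)) \<le> \<phi> y' - \<phi> y}"

definition cost ::
    "nat \<Rightarrow> (nat \<Rightarrow> 'x \<times> 'u \<times> 'w \<Rightarrow> real) \<Rightarrow> ('x \<Rightarrow> real) \<Rightarrow> (nat \<Rightarrow> 'w) \<Rightarrow>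
     (nat \<Rightarrow> 'x) \<times> (nat \<Rightarrow> 'u) \<Rightarrow> real" where
  "cost N h hN w = (\<lambda>(x, u). (\<Sum>k<N. h k (x k, u k, w k)) + hN (x N))"

definition feasible ::
    "nat \<Rightarrow> (nat \<Rightarrow> 'x::real_vector set) \<Rightarrow> (nat \<Rightarrow> 'u set) \<Rightarrow> 'x set \<Rightarrow> (nat \<Rightarrow> 'u set) \<Rightarrow>
     (nat \<Rightarrow> 'x \<Rightarrow> 'x) \<Rightarrow> (nat \<Rightarrow> 'u \<Rightarrow> 'x) \<Rightarrow> (nat \<Rightarrow> 'w \<Rightarrow> 'x) \<Rightarrow> (nat \<Rightarrow> 'w) \<Rightarrow>
     ((nat \<Rightarrow> 'x) \<times> (nat \<Rightarrow> 'u)) set" where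
  "feasible N X U C \<Omega> A B T w =
     {(x, u) \<in> PiE {..N} X \<times> PiE {..<N} U.
        (\<forall>k<N. x (Suc k) = A k (x k) + B k (u k) + T k (w k) \<and> u k \<in> \<Omega> k) \<and> x 0 \<in> C}"

definition opt_value ::
    "nat \<Rightarrow> (nat \<Rightarrow> 'x::real_vector set) \<Rightarrow> (nat \<Rightarrow> 'u set) \<Rightarrow> 'x set \<Rightarrow> (nat \<Rightarrow> 'u set) \<Rightarrow>
     (nat \<Rightarrow> 'x \<Rightarrow> 'x) \<Rightarrow> (nat \<Rightarrow> 'u \<Rightarrow> 'x) \<Rightarrow> (nat \<Rightarrow> 'w \<Rightarrow> 'x) \<Rightarrow>
     (nat \<Rightarrow> 'x \<times> 'u \<times> 'w \<Rightarrow> real) \<Rightarrow> ('x \<Rightarrow> real) \<Rightarrow> (nat \<Rightarrow> 'w) \<Rightarrow> ereal" where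
  "opt_value N X U C \<Omega> A B T h hN w =
     (INF z\<in>feasible N X U C \<Omega> A B T w. ereal (cost N h hN w z))"

definition solutions ::
    "nat \<Rightarrow> (nat \<Rightarrow> 'x::real_vector set) \<Rightarrow> (nat \<Rightarrow> 'u set) \<Rightarrow> 'x set \<Rightarrow> (nat \<Rightarrow> 'u set) \<Rightarrow>
     (nat \<Rightarrow> 'x \<Rightarrow> 'x) \<Rightarrow> (nat \<Rightarrow> 'u \<Rightarrow> 'x) \<Rightarrow> (nat \<Rightarrow> 'w \<Rightarrow> 'x) \<Rightarrow>
     (nat \<Rightarrow> 'x \<times> 'u \<times> 'w \<Rightarrow> real) \<Rightarrow> ('x \<Rightarrow> real) \<Rightarrow> (nat \<Rightarrow> 'w) \<Rightarrow>
     ((nat \<Rightarrow> 'x) \<times> (nat \<Rightarrow> 'u)) set" where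
  "solutions N X U C \<Omega> A B T h hN w =
     {z \<in> feasible N X U C \<Omega> A B T w.
        \<forall>z'\<in>feasible N X U C \<Omega> A B T w. cost N h hN w z \<le> cost N h hN w z'}"

text \<open>In the next two definitions \<open>j = k + 1\<close> runs through \<open>{1..N}\<close>.\<close>

definition M_op ::
    "nat \<Rightarrow> (nat \<Rightarrow> 'x \<Rightarrow> 'x) \<Rightarrow> (nat \<Rightarrow> 'u \<Rightarrow> 'x) \<Rightarrow> (nat \<Rightarrow> 'x::real_vector) \<times> (nat \<Rightarrow> 'u) \<Rightarrow>
     nat \<Rightarrow> 'x" where
  "M_op N A B = (\<lambda>(x, u). \<lambda>j\<in>{1..N}. - A (j - 1) (x (j - 1)) + x j - B (j - 1) (u (j - 1)))"

definition T_op :: "nat \<Rightarrow> (nat \<Rightarrow> 'w \<Rightarrow> 'x) \<Rightarrow> (nat \<Rightarrow> 'w) \<Rightarrow> nat \<Rightarrow> 'x" where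
  "T_op N T w = (\<lambda>j\<in>{1..N}. T (j - 1) (w (j - 1)))"

definition Phi_op ::
    "nat \<Rightarrow> (nat \<Rightarrow> 'x \<Rightarrow> 'x) \<Rightarrow> (nat \<Rightarrow> 'u \<Rightarrow> 'x) \<Rightarrow> (nat \<Rightarrow> 'w \<Rightarrow> 'x) \<Rightarrow>
     (nat \<Rightarrow> 'w) \<times> (nat \<Rightarrow> 'x::real_vector) \<times> (nat \<Rightarrow> 'u) \<Rightarrow> nat \<Rightarrow> 'x" where
  "Phi_op N A B T = (\<lambda>(w, z). \<lambda>j\<in>{1..N}. - T_op N T w j + M_op N A B z j)"

end

theory Submission
  imports Defs
begin

text \<open>
  The dynamics determine the states from the initial state \<open>x\<^sub>0\<close>, the controls \<open>u\<close> and the parameter \<open>w\<close>.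
  So \<open>V\<close> is the marginal function of a convex function of \<open>(x\<^sub>0, u, w)\<close> that is differentiable
  everywhere, over the product \<open>C \<times> \<Omega> \<times> W\<close>, and its subgradients can be found by Fermat's rule alone.

  By the definition of the infimum, \<open>w\<^sup>*\<close> is a subgradient of \<open>V\<close> iff the difference between the cost
  of any process and that of the reference process is at least \<open>\<langle>w\<^sup>*, w - wb\<rangle>\<close>
  (\<open>subdifferential_iff_cost\<close>). Processes can be joined to the reference process by a segment of
  processes, on which the cost is convex and differentiable; hence the cost difference may be
  replaced in this inequality by the derivative \<open>dcost\<close> of the cost along the segment
  (\<open>subdifferential_iff_dcost\<close>).

  The adjoint state \<open>p\<close> of the backward recursion \<open>p\<^sub>N = \<nabla>h\<^sub>N\<close>, \<open>p\<^sub>k = \<nabla>\<^sub>x h\<^sub>k + A\<^sub>k\<^sup>* p\<^sub>k\<^sub>+\<^sub>1\<close> eliminates the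
  intermediate states: summation by parts turns \<open>dcost\<close> into a sum of one term in the increment of
  \<open>x\<^sub>0\<close>, one in that of \<open>u\<close> and one in that of \<open>w\<close> (\<open>dcost_adjoint\<close>). These increments can be chosen
  independently (\<open>exists_trajectory\<close>), so the inequality splits into three
  (\<open>subdifferential_iff_adjoint\<close>): the first two say that \<open>-p\<^sub>0\<close> and \<open>-(\<nabla>\<^sub>u h\<^sub>k + B\<^sub>k\<^sup>* p\<^sub>k\<^sub>+\<^sub>1)\<^sub>k\<close> are normal
  to \<open>C\<close> and \<open>\<Omega>\<close>; the third, in which the increment ranges over a linear space, is the equation for
  \<open>w\<^sup>*\<close>. The multipliers of the theorem are thus \<open>x\<^sub>k\<^sup>* = p\<^sub>k\<close> for \<open>k \<ge> 1\<close> and \<open>x\<^sub>0\<^sup>* = -p\<^sub>0\<close>.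
\<close>

section \<open>Continuous linear functionals on a subspace\<close>

lemma cont_dual_add:
  "f \<in> cont_dual S \<Longrightarrow> a \<in> S \<Longrightarrow> b \<in> S \<Longrightarrow> f (a + b) = f a + f b"
  by (auto simp: cont_dual_def cont_linear_between_def linear_between_def)

lemma cont_dual_scale:
  "f \<in> cont_dual S \<Longrightarrow> a \<in> S \<Longrightarrow> f (c *\<^sub>R a) = c * f a"
  by (auto simp: cont_dual_def cont_linear_between_def linear_between_def)

lemma cont_dual_zero: "f \<in> cont_dual S \<Longrightarrow> subspace S \<Longrightarrow> f 0 = 0"
  using cont_dual_scale[of f S 0 0] by (simp add: subspace_0)

lemma cont_dual_minus: "f \<in> cont_dual S \<Longrightarrow> a \<in> S \<Longrightarrow> f (- a) = - f a"
  using cont_dual_scale[of f S a "-1"] by simp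

lemma cont_dualI:
  assumes "f \<in> extensional S" "continuous_on S f"
    and "\<And>a b. a \<in> S \<Longrightarrow> b \<in> S \<Longrightarrow> f (a + b) = f a + f b"
    and "\<And>c a. a \<in> S \<Longrightarrow> f (c *\<^sub>R a) = c * f a"
  shows "f \<in> cont_dual S"
  using assms by (auto simp: cont_dual_def cont_linear_between_def linear_between_def)

lemma cont_dual_continuous: "f \<in> cont_dual S \<Longrightarrow> continuous_on S f"
  by (auto simp: cont_dual_def cont_linear_between_def)

lemma cont_dual_restrict_sum:
  assumes S: "subspace S" and f: "f \<in> cont_dual S" and g: "g \<in> cont_dual S"
  shows "(\<lambda>v\<in>S. f v + g v) \<in> cont_dual S"
proof (rule cont_dualI)
  show "continuous_on S (\<lambda>v\<in>S. f v + g v)"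
    using continuous_on_add[OF cont_dual_continuous[OF f] cont_dual_continuous[OF g]]
    by (simp cong: continuous_on_cong)
qed (use f g S in \<open>auto simp: cont_dual_add cont_dual_scale subspace_add subspace_mul algebra_simps\<close>)

lemma cont_dual_restrict_uminus:
  assumes S: "subspace S" and f: "f \<in> cont_dual S"
  shows "(\<lambda>v\<in>S. - f v) \<in> cont_dual S"
proof (rule cont_dualI)
  show "continuous_on S (\<lambda>v\<in>S. - f v)"
    using continuous_on_minus[OF cont_dual_continuous[OF f]]
    by (simp cong: continuous_on_cong)
qed (use f S in \<open>auto simp: cont_dual_add cont_dual_scale subspace_add subspace_mul\<close>)

lemma linear_between_mem: "linear_between S S' L \<Longrightarrow> a \<in> S \<Longrightarrow> L a \<in> S'"
  by (auto simp: linear_between_def)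

lemma linear_between_add:
  "linear_between S S' L \<Longrightarrow> a \<in> S \<Longrightarrow> b \<in> S \<Longrightarrow> L (a + b) = L a + L b"
  by (auto simp: linear_between_def)

lemma linear_between_scale:
  "linear_between S S' L \<Longrightarrow> a \<in> S \<Longrightarrow> L (c *\<^sub>R a) = c *\<^sub>R L a"
  by (auto simp: linear_between_def)

lemma linear_between_diff:
  assumes "linear_between S S' L" "subspace S" "a \<in> S" "b \<in> S"
  shows "L (a - b) = L a - L b"
  using linear_between_add[of S S' L "a - b" b] assms by (simp add: subspace_diff)

lemma adjoint_on_cont_dual:
  assumes S: "subspace S" and L: "cont_linear_between S S' L" and f: "f \<in> cont_dual S'"
  shows "adjoint_on S L f \<in> cont_dual S"
proof (rule cont_dualI)
  have lin: "linear_between S S' L" and cont: "continuous_on S L"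
    using L by (auto simp: cont_linear_between_def)
  have mem: "L ` S \<subseteq> S'" using linear_between_mem[OF lin] by blast
  have "continuous_on S (\<lambda>v. f (L v))"
    by (rule continuous_on_compose2[OF cont_dual_continuous[OF f] cont mem])
  then show "continuous_on S (adjoint_on S L f)"
    by (simp add: adjoint_on_def cong: continuous_on_cong)
  show "adjoint_on S L f (a + b) = adjoint_on S L f a + adjoint_on S L f b"
    if "a \<in> S" "b \<in> S" for a b
    using that S mem lin f
    by (simp add: adjoint_on_def subspace_add linear_between_add cont_dual_add image_subset_iff)
  show "adjoint_on S L f (c *\<^sub>R a) = c * adjoint_on S L f a" if "a \<in> S" for a c
    using that S mem lin f
    by (simp add: adjoint_on_def subspace_mul linear_between_scale cont_dual_scale image_subset_iff)
qed (simp add: adjoint_on_def)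

section \<open>Differentiable convex functions on a subspace\<close>

text \<open>Convexity and minimality are statements about segments, so the Frechet derivatives of the costs
  enter the argument through their one-sided limits along rays.\<close>

lemma has_frechet_on_directional:
  assumes S: "subspace S" and x: "x \<in> S" and v: "v \<in> S" and D: "has_frechet_on S f D x"
  shows "((\<lambda>t. (f (x + t *\<^sub>R v) - f x) / t) \<longlongrightarrow> D v) (at_right (0::real))"
proof (cases "v = 0")
  case True
  have "D v = 0" using D True S by (auto simp: has_frechet_on_def cont_dual_zero)
  with True show ?thesis by simp
next
  case False
  have dual: "D \<in> cont_dual S" using D by (simp add: has_frechet_on_def)
  have "filterlim (\<lambda>t. x + t *\<^sub>R v) (at x within S) (at_right (0::real))"
  proof -
    have "((\<lambda>t. x + t *\<^sub>R v) \<longlongrightarrow> x + 0 *\<^sub>R v) (at_right (0::real))"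
      by (intro tendsto_intros)
    moreover have "\<forall>\<^sub>F t in at_right (0::real). x + t *\<^sub>R v \<in> S \<and> x + t *\<^sub>R v \<noteq> x"
      unfolding eventually_at_filter using False S x v by (auto simp: subspace_add subspace_mul)
    ultimately show ?thesis by (auto simp: filterlim_at elim: eventually_mono)
  qed
  then have "((\<lambda>t. (f (x + t *\<^sub>R v) - f x - D (t *\<^sub>R v)) / norm (t *\<^sub>R v)) \<longlongrightarrow> 0)
      (at_right (0::real))"
    using filterlim_compose[of _ "nhds 0" "at x within S"] D
    unfolding has_frechet_on_def by fastforce
  then have "((\<lambda>t. norm v * ((f (x + t *\<^sub>R v) - f x - D (t *\<^sub>R v)) / norm (t *\<^sub>R v)) + D v)
      \<longlongrightarrow> norm v * 0 + D v) (at_right (0::real))"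
    by (intro tendsto_intros)
  moreover have "\<forall>\<^sub>F t in at_right (0::real).
      norm v * ((f (x + t *\<^sub>R v) - f x - D (t *\<^sub>R v)) / norm (t *\<^sub>R v)) + D v
      = (f (x + t *\<^sub>R v) - f x) / t"
    unfolding eventually_at_filter
    using False cont_dual_scale[OF dual v] by (auto simp: field_simps intro!: always_eventually)
  ultimately show ?thesis by (auto intro: Lim_transform_eventually)
qed

text \<open>The difference quotients of a convex function on a segment are bounded by the one at the far
  end, and the bound passes to the limit.\<close>

lemma convex_on_gradient_inequality:
  assumes S: "subspace S" and x: "x \<in> S" and y: "y \<in> S"
    and D: "has_frechet_on S f D x" and f: "convex_on S f"
  shows "D (y - x) \<le> f y - f x"
proof (rule tendsto_upperbound)
  show "((\<lambda>t. (f (x + t *\<^sub>R (y - x)) - f x) / t) \<longlongrightarrow> D (y - x)) (at_right (0::real))"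
    using S x y D by (intro has_frechet_on_directional) (auto simp: subspace_diff)
  have "(f (x + t *\<^sub>R (y - x)) - f x) / t \<le> f y - f x" if t: "0 < t" "t < 1" for t
  proof -
    have "f ((1 - t) *\<^sub>R x + t *\<^sub>R y) \<le> (1 - t) * f x + t * f y"
      using t by (intro convex_onD[OF f]) (auto simp: x y)
    moreover have "(1 - t) *\<^sub>R x + t *\<^sub>R y = x + t *\<^sub>R (y - x)"
      by (simp add: algebra_simps)
    ultimately show ?thesis using t by (simp add: divide_simps algebra_simps)
  qed
  moreover have "\<forall>\<^sub>F t in at_right (0::real). 0 < t \<and> t < 1"
    by (rule eventually_at_rightI[of 0 1]) auto
  ultimately show "\<forall>\<^sub>F t in at_right (0::real). (f (x + t *\<^sub>R (y - x)) - f x) / t \<le> f y - f x"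
    by (auto elim: eventually_mono)
qed simp

text \<open>A chain rule for the slices \<open>y \<mapsto> (y, u, w)\<close>, \<open>(x, y, w)\<close>, \<open>(x, u, y)\<close> of a product. As the slice map
  \<open>\<phi>\<close> is an isometry with linear part \<open>e\<close>, the remainder quotient of the slice is that of \<open>f\<close>, read at
  \<open>\<phi> y\<close>.\<close>

lemma has_frechet_on_isometric_embedding:
  assumes D: "has_frechet_on S' f D (\<phi> x)" and S: "subspace S" and x: "x \<in> S"
    and \<phi>: "\<And>y. y \<in> S \<Longrightarrow> \<phi> y \<in> S'"
    and diff: "\<And>y. y \<in> S \<Longrightarrow> \<phi> y - \<phi> x = e (y - x)"
    and e: "cont_linear_between S S' e" and iso: "\<And>v. norm (e v) = norm v"
  shows "has_frechet_on S (\<lambda>y. f (\<phi> y)) (adjoint_on S e D) x"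
  unfolding has_frechet_on_def
proof
  have dual: "D \<in> cont_dual S'" using D by (simp add: has_frechet_on_def)
  show "adjoint_on S e D \<in> cont_dual S" by (rule adjoint_on_cont_dual[OF S e dual])
  have nrm: "norm (\<phi> y - \<phi> x) = norm (y - x)" if "y \<in> S" for y
    using diff[OF that] iso by simp
  have "filterlim \<phi> (at (\<phi> x) within S') (at x within S)"
    unfolding filterlim_at
  proof
    show "\<forall>\<^sub>F y in at x within S. \<phi> y \<in> S' \<and> \<phi> y \<noteq> \<phi> x"
      unfolding eventually_at_filter using \<phi> nrm
      by (auto intro!: always_eventually) (metis cancel_comm_monoid_add_class.diff_cancel norm_eq_zero right_minus_eq)
    show "(\<phi> \<longlongrightarrow> \<phi> x) (at x within S)"
      unfolding Lim_within using nrm by (auto simp: dist_norm)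
  qed
  then have "((\<lambda>y. (f (\<phi> y) - f (\<phi> x) - D (\<phi> y - \<phi> x)) / norm (\<phi> y - \<phi> x)) \<longlongrightarrow> 0)
      (at x within S)"
    using filterlim_compose[of _ "nhds 0" "at (\<phi> x) within S'"] D
    unfolding has_frechet_on_def by fastforce
  moreover have "\<forall>\<^sub>F y in at x within S.
      (f (\<phi> y) - f (\<phi> x) - D (\<phi> y - \<phi> x)) / norm (\<phi> y - \<phi> x)
      = (f (\<phi> y) - f (\<phi> x) - adjoint_on S e D (y - x)) / norm (y - x)"
    unfolding eventually_at_filter
    using nrm diff x S by (auto simp: adjoint_on_def subspace_diff iso intro!: always_eventually)
  ultimately show "((\<lambda>y. (f (\<phi> y) - f (\<phi> x) - adjoint_on S e D (y - x)) / norm (y - x)) \<longlongrightarrow> 0)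
      (at x within S)"
    by (rule Lim_transform_eventually)
qed

text \<open>Joint differentiability makes the partial derivatives sum to the total one. This allows the
  partial gradients of the stage costs to be used in place of their joint derivative.\<close>

lemma has_frechet_on_partials:
  fixes S1 :: "'a::real_normed_vector set" and S2 :: "'b::real_normed_vector set"
    and S3 :: "'c::real_normed_vector set"
  assumes S: "subspace S1" "subspace S2" "subspace S3"
    and m: "x \<in> S1" "u \<in> S2" "w \<in> S3"
    and diff: "frechet_differentiable_on (S1 \<times> S2 \<times> S3) f"
  defines "gx \<equiv> frechet_deriv_on S1 (\<lambda>x. f (x, u, w)) x"
    and "gu \<equiv> frechet_deriv_on S2 (\<lambda>u. f (x, u, w)) u"
    and "gw \<equiv> frechet_deriv_on S3 (\<lambda>w. f (x, u, w)) w"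
  shows "gx \<in> cont_dual S1" "gu \<in> cont_dual S2" "gw \<in> cont_dual S3"
    and "has_frechet_on (S1 \<times> S2 \<times> S3) f
           (\<lambda>(a, b, c)\<in>S1 \<times> S2 \<times> S3. gx a + gu b + gw c) (x, u, w)"
proof -
  obtain D where D: "has_frechet_on (S1 \<times> S2 \<times> S3) f D (x, u, w)"
    using diff m unfolding frechet_differentiable_on_def by blast
  then have dual: "D \<in> cont_dual (S1 \<times> S2 \<times> S3)" by (simp add: has_frechet_on_def)
  note z = S[THEN subspace_0]
  have e1: "cont_linear_between S1 (S1 \<times> S2 \<times> S3) (\<lambda>v. (v, 0, 0))"
    and e2: "cont_linear_between S2 (S1 \<times> S2 \<times> S3) (\<lambda>v. (0, v, 0))"
    and e3: "cont_linear_between S3 (S1 \<times> S2 \<times> S3) (\<lambda>v. (0, 0, v))"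
    using z by (auto simp: cont_linear_between_def linear_between_def
        intro!: continuous_intros)
  have "has_frechet_on S1 (\<lambda>x. f (x, u, w)) (adjoint_on S1 (\<lambda>v. (v, 0, 0)) D) x"
    by (rule has_frechet_on_isometric_embedding[where \<phi> = "\<lambda>y. (y, u, w)", OF D S(1) m(1) _ _ e1])
      (use m in \<open>auto simp: norm_Pair zero_prod_def\<close>)
  then have g1: "gx = adjoint_on S1 (\<lambda>v. (v, 0, 0)) D"
    unfolding gx_def by (rule frechet_deriv_on_eqI[OF S(1) m(1)])
  have "has_frechet_on S2 (\<lambda>u. f (x, u, w)) (adjoint_on S2 (\<lambda>v. (0, v, 0)) D) u"
    by (rule has_frechet_on_isometric_embedding[where \<phi> = "\<lambda>y. (x, y, w)", OF D S(2) m(2) _ _ e2])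
      (use m in \<open>auto simp: norm_Pair zero_prod_def\<close>)
  then have g2: "gu = adjoint_on S2 (\<lambda>v. (0, v, 0)) D"
    unfolding gu_def by (rule frechet_deriv_on_eqI[OF S(2) m(2)])
  have "has_frechet_on S3 (\<lambda>w. f (x, u, w)) (adjoint_on S3 (\<lambda>v. (0, 0, v)) D) w"
    by (rule has_frechet_on_isometric_embedding[where \<phi> = "\<lambda>y. (x, u, y)", OF D S(3) m(3) _ _ e3])
      (use m in \<open>auto simp: norm_Pair zero_prod_def\<close>)
  then have g3: "gw = adjoint_on S3 (\<lambda>v. (0, 0, v)) D"
    unfolding gw_def by (rule frechet_deriv_on_eqI[OF S(3) m(3)])
  show "gx \<in> cont_dual S1" "gu \<in> cont_dual S2" "gw \<in> cont_dual S3"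
    unfolding g1 g2 g3 using adjoint_on_cont_dual[OF S(1) e1 dual]
      adjoint_on_cont_dual[OF S(2) e2 dual] adjoint_on_cont_dual[OF S(3) e3 dual] by auto
  have "D = (\<lambda>(a, b, c)\<in>S1 \<times> S2 \<times> S3. gx a + gu b + gw c)"
  proof (rule extensionalityI)
    show "D \<in> extensional (S1 \<times> S2 \<times> S3)" using dual by (simp add: cont_dual_def)
    fix d assume d: "d \<in> S1 \<times> S2 \<times> S3"
    then obtain a b c where abc: "d = (a, b, c)" "a \<in> S1" "b \<in> S2" "c \<in> S3" by auto
    have "d = (a, 0, 0) + ((0, b, 0) + (0, 0, c))" using abc by simp
    then have "D d = D (a, 0, 0) + (D (0, b, 0) + D (0, 0, c))"
      using cont_dual_add[OF dual, of "(a, 0, 0)" "(0, b, 0) + (0, 0, c)"]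
        cont_dual_add[OF dual, of "(0, b, 0)" "(0, 0, c)"] abc z by auto
    then show "D d = (\<lambda>(a, b, c)\<in>S1 \<times> S2 \<times> S3. gx a + gu b + gw c) d"
      using abc by (simp add: g1 g2 g3 adjoint_on_def)
  qed simp
  with D show "has_frechet_on (S1 \<times> S2 \<times> S3) f
      (\<lambda>(a, b, c)\<in>S1 \<times> S2 \<times> S3. gx a + gu b + gw c) (x, u, w)" by simp
qed

section \<open>First-order optimality on segments of processes\<close>

text \<open>The reference process \<open>(xb, ub)\<close> is optimal for \<open>wb\<close>, and \<open>gx\<close>, \<open>gu\<close>, \<open>gw\<close>, \<open>gN\<close> are the gradients of
  the costs there. They are parameters, tied to the costs by a joint derivative in split form, so
  that no argument in the locale has to mention partial derivatives.\<close>

locale differentiable_control_problem =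
  fixes N :: nat
    and X :: "nat \<Rightarrow> 'x::real_normed_vector set"
    and U :: "nat \<Rightarrow> 'u::real_normed_vector set"
    and W :: "nat \<Rightarrow> 'w::real_normed_vector set"
    and C :: "'x set" and \<Omega> :: "nat \<Rightarrow> 'u set"
    and A :: "nat \<Rightarrow> 'x \<Rightarrow> 'x" and B :: "nat \<Rightarrow> 'u \<Rightarrow> 'x" and T :: "nat \<Rightarrow> 'w \<Rightarrow> 'x"
    and h :: "nat \<Rightarrow> 'x \<times> 'u \<times> 'w \<Rightarrow> real" and hN :: "'x \<Rightarrow> real"
    and xb :: "nat \<Rightarrow> 'x" and ub :: "nat \<Rightarrow> 'u" and wb :: "nat \<Rightarrow> 'w"
    and gx :: "nat \<Rightarrow> 'x \<Rightarrow> real" and gu :: "nat \<Rightarrow> 'u \<Rightarrow> real" and gw :: "nat \<Rightarrow> 'w \<Rightarrow> real"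
    and gN :: "'x \<Rightarrow> real"
  assumes X: "k \<le> N \<Longrightarrow> subspace (X k)"
    and U: "k < N \<Longrightarrow> subspace (U k)"
    and W: "k < N \<Longrightarrow> subspace (W k)"
    and C: "C \<subseteq> X 0" "convex C"
    and \<Omega>: "k < N \<Longrightarrow> \<Omega> k \<subseteq> U k" "k < N \<Longrightarrow> convex (\<Omega> k)"
    and A: "k < N \<Longrightarrow> linear_between (X k) (X (Suc k)) (A k)"
    and B: "k < N \<Longrightarrow> linear_between (U k) (X (Suc k)) (B k)"
    and T: "k < N \<Longrightarrow> linear_between (W k) (X (Suc k)) (T k)"
    and h_convex: "k < N \<Longrightarrow> convex_on (X k \<times> U k \<times> W k) (h k)"
    and hN_convex: "convex_on (X N) hN"
    and wb: "wb \<in> PiE {..<N} W"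
    and sol: "(xb, ub) \<in> solutions N X U C \<Omega> A B T h hN wb"
    and h_deriv: "k < N \<Longrightarrow> has_frechet_on (X k \<times> U k \<times> W k) (h k)
          (\<lambda>(a, b, c)\<in>X k \<times> U k \<times> W k. gx k a + gu k b + gw k c) (xb k, ub k, wb k)"
    and hN_deriv: "has_frechet_on (X N) hN gN (xb N)"
begin

abbreviation (input) "F \<equiv> feasible N X U C \<Omega> A B T"
abbreviation (input) "V \<equiv> opt_value N X U C \<Omega> A B T h hN"

definition dcost :: "(nat \<Rightarrow> 'x) \<Rightarrow> (nat \<Rightarrow> 'u) \<Rightarrow> (nat \<Rightarrow> 'w) \<Rightarrow> real" where
  "dcost a b c = (\<Sum>k<N. gx k (a k) + gu k (b k) + gw k (c k)) + gN (a N)"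

lemma feasibleD:
  assumes "(x, u) \<in> F w"
  shows "x \<in> PiE {..N} X" "u \<in> PiE {..<N} U" "x 0 \<in> C"
    "k < N \<Longrightarrow> x (Suc k) = A k (x k) + B k (u k) + T k (w k)" "k < N \<Longrightarrow> u k \<in> \<Omega> k"
    "k \<le> N \<Longrightarrow> x k \<in> X k" "k < N \<Longrightarrow> u k \<in> U k"
  using assms by (auto simp: feasible_def PiE_def Pi_def)

lemma reference_feasible: "(xb, ub) \<in> F wb"
  using sol by (simp add: solutions_def)

lemmas referenceD = feasibleD[OF reference_feasible]

lemma wbD: "k < N \<Longrightarrow> wb k \<in> W k"
  using wb by auto

lemma opt_value_reference: "V wb = ereal (cost N h hN wb (xb, ub))"
  unfolding opt_value_def
proof (rule antisym)
  show "(INF z\<in>F wb. ereal (cost N h hN wb z)) \<le> ereal (cost N h hN wb (xb, ub))"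
    by (rule INF_lower[OF reference_feasible])
  show "ereal (cost N h hN wb (xb, ub)) \<le> (INF z\<in>F wb. ereal (cost N h hN wb z))"
    using sol by (intro INF_greatest) (simp add: solutions_def)
qed

text \<open>The reference process attains \<open>V wb\<close>, and a number is below the infimum \<open>V w\<close> iff it is below every
  feasible cost; an empty infimum \<open>\<infinity>\<close> gives no condition on either side.\<close>

lemma subdifferential_iff_cost:
  assumes ws: "ws \<in> tuple_dual {..<N} W"
  shows "ws \<in> tuple_subdifferential {..<N} W V wb \<longleftrightarrow>
    (\<forall>w\<in>PiE {..<N} W. \<forall>x u. (x, u) \<in> F w \<longrightarrow>
       (\<Sum>k<N. ws k (w k - wb k)) \<le> cost N h hN w (x, u) - cost N h hN wb (xb, ub))"
proof -
  have pair: "pairing {..<N} ws (\<lambda>k\<in>{..<N}. w k - wb k) = (\<Sum>k<N. ws k (w k - wb k))" for w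
    by (simp add: pairing_def)
  have shift: "ereal s \<le> v - ereal c \<longleftrightarrow> ereal (s + c) \<le> v" for s c v
    by (cases v) auto
  show ?thesis
    using ws unfolding tuple_subdifferential_def opt_value_reference pair mem_Collect_eq shift
    by (auto simp: opt_value_def le_INF_iff algebra_simps)
qed

lemma dcost_le_cost_diff:
  assumes w: "w \<in> PiE {..<N} W" and xu: "(x, u) \<in> F w"
  shows "dcost (\<lambda>k. x k - xb k) (\<lambda>k. u k - ub k) (\<lambda>k. w k - wb k)
      \<le> cost N h hN w (x, u) - cost N h hN wb (xb, ub)"
proof -
  note z = feasibleD[OF xu]
  have "gx k (x k - xb k) + gu k (u k - ub k) + gw k (w k - wb k)
      \<le> h k (x k, u k, w k) - h k (xb k, ub k, wb k)" if k: "k < N" for k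
  proof -
    have s: "subspace (X k \<times> U k \<times> W k)"
      using k by (intro subspace_Times X U W) auto
    have wk: "w k \<in> W k" using w k by auto
    have "(x k - xb k, u k - ub k, w k - wb k) \<in> X k \<times> U k \<times> W k"
      using k z(6,7) referenceD(6,7) wbD wk by (auto intro!: subspace_diff X U W)
    then show ?thesis
      using convex_on_gradient_inequality[OF s _ _ h_deriv[OF k] h_convex[OF k], of "(x k, u k, w k)"]
        k z(6,7) referenceD(6,7) wbD wk by auto
  qed
  then have "(\<Sum>k<N. gx k (x k - xb k) + gu k (u k - ub k) + gw k (w k - wb k))
      \<le> (\<Sum>k<N. h k (x k, u k, w k) - h k (xb k, ub k, wb k))"
    by (intro sum_mono) auto
  moreover have "gN (x N - xb N) \<le> hN (x N) - hN (xb N)"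
    using convex_on_gradient_inequality[OF X _ _ hN_deriv hN_convex] z(6) referenceD(6) by auto
  ultimately show ?thesis
    by (simp add: dcost_def cost_def sum_subtractf)
qed

lemma cost_directional:
  assumes "\<And>k. k \<le> N \<Longrightarrow> a k \<in> X k" "\<And>k. k < N \<Longrightarrow> b k \<in> U k" "\<And>k. k < N \<Longrightarrow> c k \<in> W k"
  shows "((\<lambda>t. (cost N h hN (\<lambda>k\<in>{..<N}. wb k + t *\<^sub>R c k)
              (\<lambda>k\<in>{..N}. xb k + t *\<^sub>R a k, \<lambda>k\<in>{..<N}. ub k + t *\<^sub>R b k)
            - cost N h hN wb (xb, ub)) / t) \<longlongrightarrow> dcost a b c) (at_right (0::real))"
proof -
  have "((\<lambda>t. (h k (xb k + t *\<^sub>R a k, ub k + t *\<^sub>R b k, wb k + t *\<^sub>R c k)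
        - h k (xb k, ub k, wb k)) / t) \<longlongrightarrow> gx k (a k) + gu k (b k) + gw k (c k))
      (at_right (0::real))" if k: "k < N" for k
  proof -
    have s: "subspace (X k \<times> U k \<times> W k)"
      using k by (intro subspace_Times X U W) auto
    show ?thesis
      using has_frechet_on_directional[OF s _ _ h_deriv[OF k], of "(a k, b k, c k)"]
        k referenceD(6,7) wbD assms by auto
  qed
  moreover have "((\<lambda>t. (hN (xb N + t *\<^sub>R a N) - hN (xb N)) / t) \<longlongrightarrow> gN (a N)) (at_right (0::real))"
    using has_frechet_on_directional[OF X _ _ hN_deriv] referenceD(6) assms by auto
  ultimately have "((\<lambda>t. (\<Sum>k<N. (h k (xb k + t *\<^sub>R a k, ub k + t *\<^sub>R b k, wb k + t *\<^sub>R c k)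
        - h k (xb k, ub k, wb k)) / t) + (hN (xb N + t *\<^sub>R a N) - hN (xb N)) / t)
      \<longlongrightarrow> dcost a b c) (at_right (0::real))"
    unfolding dcost_def by (intro tendsto_add tendsto_sum) auto
  moreover have "cost N h hN (\<lambda>k\<in>{..<N}. wb k + t *\<^sub>R c k)
          (\<lambda>k\<in>{..N}. xb k + t *\<^sub>R a k, \<lambda>k\<in>{..<N}. ub k + t *\<^sub>R b k) - cost N h hN wb (xb, ub)
        = (\<Sum>k<N. h k (xb k + t *\<^sub>R a k, ub k + t *\<^sub>R b k, wb k + t *\<^sub>R c k)
        - h k (xb k, ub k, wb k)) + (hN (xb N + t *\<^sub>R a N) - hN (xb N))" for t
    by (simp add: cost_def sum_subtractf)
  ultimately show ?thesis
    by (simp add: add_divide_distrib sum_divide_distrib)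
qed

text \<open>The dynamics are linear and the constraint sets convex, so feasible pairs of a parameter and
  a process form a convex set.\<close>

lemma feasible_segment:
  assumes w: "w \<in> PiE {..<N} W" and xu: "(x, u) \<in> F w" and t: "0 \<le> t" "t \<le> 1"
  shows "(\<lambda>k\<in>{..N}. xb k + t *\<^sub>R (x k - xb k), \<lambda>k\<in>{..<N}. ub k + t *\<^sub>R (u k - ub k))
      \<in> F (\<lambda>k\<in>{..<N}. wb k + t *\<^sub>R (w k - wb k))"
proof -
  note z = feasibleD[OF xu]
  have convex_mem: "p + t *\<^sub>R (q - p) \<in> S" if "convex S" "p \<in> S" "q \<in> S" for S and p q :: "'z::real_vector"
  proof -
    have "(1 - t) *\<^sub>R p + t *\<^sub>R q \<in> S" using convexD_alt[of S p q t] that t by auto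
    then show ?thesis by (simp add: algebra_simps)
  qed
  have lin: "L (p + t *\<^sub>R (q - p)) = L p + t *\<^sub>R (L q - L p)"
    if "linear_between S S' L" "subspace S" "p \<in> S" "q \<in> S"
    for S S' and L :: "'z::real_vector \<Rightarrow> 'x" and p q
    using that by (simp add: linear_between_add[of S S'] linear_between_scale[of S S']
        linear_between_diff[of S S'] subspace_diff subspace_mul)
  have "xb (Suc k) + t *\<^sub>R (x (Suc k) - xb (Suc k))
      = A k (xb k + t *\<^sub>R (x k - xb k)) + B k (ub k + t *\<^sub>R (u k - ub k))
        + T k (wb k + t *\<^sub>R (w k - wb k))" if k: "k < N" for k
  proof -
    have eA: "A k (xb k + t *\<^sub>R (x k - xb k)) = A k (xb k) + t *\<^sub>R (A k (x k) - A k (xb k))"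
      using k z(6) referenceD(6) by (intro lin[OF A X]) auto
    have eB: "B k (ub k + t *\<^sub>R (u k - ub k)) = B k (ub k) + t *\<^sub>R (B k (u k) - B k (ub k))"
      using k z(7) referenceD(7) by (intro lin[OF B U]) auto
    have eT: "T k (wb k + t *\<^sub>R (w k - wb k)) = T k (wb k) + t *\<^sub>R (T k (w k) - T k (wb k))"
      using k w wbD by (intro lin[OF T W]) auto
    show ?thesis
      unfolding eA eB eT z(4)[OF k] referenceD(4)[OF k] by (simp add: algebra_simps)
  qed
  moreover have "xb k + t *\<^sub>R (x k - xb k) \<in> X k" if "k \<le> N" for k
    using that z(6) referenceD(6) X by (auto intro!: convex_mem subspace_imp_convex)
  moreover have "ub k + t *\<^sub>R (u k - ub k) \<in> U k" if "k < N" for k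
    using that z(7) referenceD(7) U by (auto intro!: convex_mem subspace_imp_convex)
  moreover have "ub k + t *\<^sub>R (u k - ub k) \<in> \<Omega> k" if "k < N" for k
    using that z(5) referenceD(5) \<Omega>(2) by (auto intro!: convex_mem)
  moreover have "xb 0 + t *\<^sub>R (x 0 - xb 0) \<in> C"
    using z(3) referenceD(3) C by (auto intro!: convex_mem)
  ultimately show ?thesis by (auto simp: feasible_def)
qed

text \<open>This is where convexity reduces a global inequality to a first-order one. The gradient inequality
  gives one direction. For the other, the global inequality at the points of a feasible segment is
  divided by the step length \<open>t\<close>, and \<open>t\<close> tends to \<open>0\<close>.\<close>

lemma subdifferential_iff_dcost:
  assumes ws: "ws \<in> tuple_dual {..<N} W"
  shows "ws \<in> tuple_subdifferential {..<N} W V wb \<longleftrightarrow>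
    (\<forall>w\<in>PiE {..<N} W. \<forall>x u. (x, u) \<in> F w \<longrightarrow>
       (\<Sum>k<N. ws k (w k - wb k)) \<le> dcost (\<lambda>k. x k - xb k) (\<lambda>k. u k - ub k) (\<lambda>k. w k - wb k))"
    (is "_ \<longleftrightarrow> ?R")
proof
  assume ?R
  then show "ws \<in> tuple_subdifferential {..<N} W V wb"
    unfolding subdifferential_iff_cost[OF ws] using dcost_le_cost_diff by (meson order_trans)
next
  assume "ws \<in> tuple_subdifferential {..<N} W V wb"
  then have global: "(\<Sum>k<N. ws k (w k - wb k)) \<le> cost N h hN w (x, u) - cost N h hN wb (xb, ub)"
    if "w \<in> PiE {..<N} W" "(x, u) \<in> F w" for w x u
    using that unfolding subdifferential_iff_cost[OF ws] by blast
  show ?R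
  proof (intro ballI allI impI)
    fix w x u assume w: "w \<in> PiE {..<N} W" and xu: "(x, u) \<in> F w"
    note z = feasibleD[OF xu]
    let ?w = "\<lambda>t. \<lambda>k\<in>{..<N}. wb k + t *\<^sub>R (w k - wb k)"
    let ?x = "\<lambda>t. \<lambda>k\<in>{..N}. xb k + t *\<^sub>R (x k - xb k)"
    let ?u = "\<lambda>t. \<lambda>k\<in>{..<N}. ub k + t *\<^sub>R (u k - ub k)"
    have dw: "w k - wb k \<in> W k" if "k < N" for k
      using that w wbD W by (auto intro!: subspace_diff)
    have quotient: "(\<Sum>k<N. ws k (w k - wb k))
        \<le> (cost N h hN (?w t) (?x t, ?u t) - cost N h hN wb (xb, ub)) / t"
      if t: "0 < t" "t < 1" for t
    proof -
      have "?w t \<in> PiE {..<N} W"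
        using dw wbD W by (auto intro!: subspace_add subspace_mul)
      then have "(\<Sum>k<N. ws k (?w t k - wb k))
          \<le> cost N h hN (?w t) (?x t, ?u t) - cost N h hN wb (xb, ub)"
        by (rule global) (rule feasible_segment[OF w xu], use t in auto)
      moreover have "(\<Sum>k<N. ws k (?w t k - wb k)) = t * (\<Sum>k<N. ws k (w k - wb k))"
        unfolding sum_distrib_left
      proof (rule sum.cong)
        fix k assume "k \<in> {..<N}"
        then show "ws k (?w t k - wb k) = t * ws k (w k - wb k)"
          using ws dw by (auto simp: tuple_dual_def PiE_iff intro!: cont_dual_scale)
      qed simp
      ultimately show ?thesis using t by (simp add: field_simps)
    qed
    show "(\<Sum>k<N. ws k (w k - wb k))
        \<le> dcost (\<lambda>k. x k - xb k) (\<lambda>k. u k - ub k) (\<lambda>k. w k - wb k)"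
    proof (rule tendsto_lowerbound)
      show "((\<lambda>t. (cost N h hN (?w t) (?x t, ?u t) - cost N h hN wb (xb, ub)) / t)
          \<longlongrightarrow> dcost (\<lambda>k. x k - xb k) (\<lambda>k. u k - ub k) (\<lambda>k. w k - wb k)) (at_right 0)"
        using z(6,7) referenceD(6,7) dw X U by (intro cost_directional) (auto intro!: subspace_diff)
      have "\<forall>\<^sub>F t in at_right (0::real). 0 < t \<and> t < 1"
        by (rule eventually_at_rightI[of 0 1]) auto
      then show "\<forall>\<^sub>F t in at_right 0. (\<Sum>k<N. ws k (w k - wb k))
          \<le> (cost N h hN (?w t) (?x t, ?u t) - cost N h hN wb (xb, ub)) / t"
        by (rule eventually_mono) (use quotient in blast)
    qed simp
  qed
qed

section \<open>The adjoint state\<close>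

text \<open>Summation by parts. Increments \<open>a\<close>, \<open>b\<close>, \<open>c\<close> of state, control and parameter satisfy the homogeneous
  dynamics, so the adjoint recursion gives
  \<open>gx\<^sub>k a\<^sub>k = p\<^sub>k a\<^sub>k - p\<^sub>k\<^sub>+\<^sub>1 a\<^sub>k\<^sub>+\<^sub>1 + p\<^sub>k\<^sub>+\<^sub>1 (B\<^sub>k b\<^sub>k) + p\<^sub>k\<^sub>+\<^sub>1 (T\<^sub>k c\<^sub>k)\<close>. The first two terms telescope, and
  the end term \<open>p\<^sub>N a\<^sub>N\<close> cancels the terminal gradient.\<close>

lemma dcost_adjoint:
  assumes p: "\<And>k. k \<le> N \<Longrightarrow> p k \<in> cont_dual (X k)"
    and pN: "\<And>v. v \<in> X N \<Longrightarrow> p N v = gN v"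
    and pk: "\<And>k v. k < N \<Longrightarrow> v \<in> X k \<Longrightarrow> p k v = gx k v + p (Suc k) (A k v)"
    and w: "w \<in> PiE {..<N} W" and xu: "(x, u) \<in> F w"
  shows "dcost (\<lambda>k. x k - xb k) (\<lambda>k. u k - ub k) (\<lambda>k. w k - wb k)
      = p 0 (x 0 - xb 0) + (\<Sum>k<N. gu k (u k - ub k) + p (Suc k) (B k (u k - ub k)))
        + (\<Sum>k<N. gw k (w k - wb k) + p (Suc k) (T k (w k - wb k)))"
proof -
  note z = feasibleD[OF xu]
  define a where "a k = x k - xb k" for k
  define b where "b k = u k - ub k" for k
  define c where "c k = w k - wb k" for k
  have a: "a k \<in> X k" if "k \<le> N" for k
    using that z(6) referenceD(6) X by (auto simp: a_def intro!: subspace_diff)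
  have b: "b k \<in> U k" if "k < N" for k
    using that z(7) referenceD(7) U by (auto simp: b_def intro!: subspace_diff)
  have c: "c k \<in> W k" if "k < N" for k
    using that w wbD W by (auto simp: c_def intro!: subspace_diff)
  have step: "gx k (a k) = p k (a k) - p (Suc k) (a (Suc k)) + p (Suc k) (B k (b k)) + p (Suc k) (T k (c k))"
    if k: "k < N" for k
  proof -
    have "A k (a k) = A k (x k) - A k (xb k)"
      using k z(6) referenceD(6) unfolding a_def by (intro linear_between_diff[OF A X]) auto
    moreover have "B k (b k) = B k (u k) - B k (ub k)"
      using k z(7) referenceD(7) unfolding b_def by (intro linear_between_diff[OF B U]) auto
    moreover have "T k (c k) = T k (w k) - T k (wb k)"
      using k w wbD unfolding c_def by (intro linear_between_diff[OF T W]) auto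
    ultimately have "a (Suc k) = A k (a k) + (B k (b k) + T k (c k))"
      using z(4)[OF k] referenceD(4)[OF k] by (simp add: a_def)
    moreover have "A k (a k) \<in> X (Suc k)" "B k (b k) \<in> X (Suc k)" "T k (c k) \<in> X (Suc k)"
      using k a b c by (auto intro: linear_between_mem[OF A] linear_between_mem[OF B]
          linear_between_mem[OF T])
    ultimately have "p (Suc k) (a (Suc k))
        = p (Suc k) (A k (a k)) + (p (Suc k) (B k (b k)) + p (Suc k) (T k (c k)))"
      using k X by (simp add: cont_dual_add[OF p] subspace_add)
    then show ?thesis using pk[OF k a] k by simp
  qed
  have "(\<Sum>k<N. gx k (a k) + gu k (b k) + gw k (c k))
      = (\<Sum>k<N. (p k (a k) - p (Suc k) (a (Suc k))) + (gu k (b k) + p (Suc k) (B k (b k)))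
          + (gw k (c k) + p (Suc k) (T k (c k))))"
    by (intro sum.cong) (auto simp: step)
  also have "\<dots> = (p 0 (a 0) - p N (a N)) + (\<Sum>k<N. gu k (b k) + p (Suc k) (B k (b k)))
        + (\<Sum>k<N. gw k (c k) + p (Suc k) (T k (c k)))"
    by (simp only: sum.distrib sum_lessThan_telescope'[of "\<lambda>k. p k (a k)"])
  finally show ?thesis
    using pN[OF a] by (simp add: dcost_def a_def b_def c_def)
qed

text \<open>Initial state, controls and parameter can be prescribed independently, since running the
  dynamics forward imposes no further constraint on the later states.\<close>

lemma exists_trajectory:
  assumes "x0 \<in> C" "\<And>k. k < N \<Longrightarrow> u k \<in> \<Omega> k" "u \<in> PiE {..<N} U" "w \<in> PiE {..<N} W"
  obtains x where "(x, u) \<in> F w" "x 0 = x0"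
proof -
  define y where "y = rec_nat x0 (\<lambda>k v. A k v + B k (u k) + T k (w k))"
  have y: "y 0 = x0" "y (Suc k) = A k (y k) + B k (u k) + T k (w k)" for k
    by (simp_all add: y_def)
  have "y k \<in> X k" if "k \<le> N" for k
    using that
  proof (induction k)
    case 0
    show ?case using y assms(1) C by auto
  next
    case (Suc k)
    then have k: "k < N" by simp
    have "u k \<in> U k" "w k \<in> W k" using assms k by auto
    then show ?case
      using Suc X[of "Suc k"] linear_between_mem[OF A[OF k]] linear_between_mem[OF B[OF k]]
        linear_between_mem[OF T[OF k]] by (auto simp: y intro!: subspace_add)
  qed
  then have "(restrict y {..N}, u) \<in> F w"
    using assms y by (auto simp: feasible_def)
  with that show thesis using y by simp
qed

text \<open>An inequality between separate functions of independent \<open>x\<^sub>0\<close>, \<open>u\<close>, \<open>w\<close>, all vanishing at the reference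
  point, holds iff it holds in each variable with the other two at the reference point.\<close>

lemma subdifferential_iff_adjoint:
  assumes p: "\<And>k. k \<le> N \<Longrightarrow> p k \<in> cont_dual (X k)"
    and pN: "\<And>v. v \<in> X N \<Longrightarrow> p N v = gN v"
    and pk: "\<And>k v. k < N \<Longrightarrow> v \<in> X k \<Longrightarrow> p k v = gx k v + p (Suc k) (A k v)"
    and gw: "\<And>k. k < N \<Longrightarrow> gw k \<in> cont_dual (W k)" and gu: "\<And>k. k < N \<Longrightarrow> gu k \<in> cont_dual (U k)"
    and ws: "ws \<in> tuple_dual {..<N} W"
  shows "ws \<in> tuple_subdifferential {..<N} W V wb \<longleftrightarrow>
    (\<forall>x0\<in>C. 0 \<le> p 0 (x0 - xb 0)) \<and>
    (\<forall>u\<in>PiE {..<N} \<Omega>. 0 \<le> (\<Sum>k<N. gu k (u k - ub k) + p (Suc k) (B k (u k - ub k)))) \<and>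
    (\<forall>k<N. \<forall>v\<in>W k. ws k v = gw k v + p (Suc k) (T k v))"
    (is "_ \<longleftrightarrow> ?C \<and> ?U \<and> ?W")
proof -
  let ?Q = "\<lambda>u. \<Sum>k<N. gu k (u k - ub k) + p (Suc k) (B k (u k - ub k))"
  let ?R = "\<lambda>w. \<Sum>k<N. gw k (w k - wb k) + p (Suc k) (T k (w k - wb k))"
  have ineq: "ws \<in> tuple_subdifferential {..<N} W V wb \<longleftrightarrow>
      (\<forall>w\<in>PiE {..<N} W. \<forall>x u. (x, u) \<in> F w \<longrightarrow>
        (\<Sum>k<N. ws k (w k - wb k)) \<le> p 0 (x 0 - xb 0) + ?Q u + ?R w)"
    unfolding subdifferential_iff_dcost[OF ws] using dcost_adjoint[OF p pN pk] by simp
  have wsk: "ws k \<in> cont_dual (W k)" if "k < N" for k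
    using ws that by (auto simp: tuple_dual_def)
  have L0: "L 0 = 0" if "linear_between S S' L" "subspace S" for S S' and L :: "'z::real_vector \<Rightarrow> 'x"
    using linear_between_scale[OF that(1) subspace_0[OF that(2)], of 0] by simp
  have zero: "p k 0 = 0" if "k \<le> N" for k using cont_dual_zero[OF p X] that by simp
  have P0: "p 0 (xb 0 - xb 0) = 0" by (simp add: zero)
  have Q0: "?Q ub = 0"
    using zero by (simp add: L0[OF B U] cont_dual_zero[OF gu U])
  have R0: "?R wb = 0"
    using zero by (simp add: L0[OF T W] cont_dual_zero[OF gw W])
  have ws0: "(\<Sum>k<N. ws k (wb k - wb k)) = 0"
    by (simp add: cont_dual_zero[OF wsk W])
  show ?thesis
  proof
    assume sub: "ws \<in> tuple_subdifferential {..<N} W V wb"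
    have *: "(\<Sum>k<N. ws k (w k - wb k)) \<le> p 0 (x0 - xb 0) + ?Q u + ?R w"
      if m: "x0 \<in> C" "u \<in> PiE {..<N} \<Omega>" "w \<in> PiE {..<N} W" for x0 u w
    proof -
      have uU: "u \<in> PiE {..<N} U" using m(2) \<Omega>(1) by (auto simp: PiE_iff)
      obtain x where "(x, u) \<in> F w" "x 0 = x0"
        by (rule exists_trajectory[of x0 u w]) (use m uU in auto)
      with m(3) sub show ?thesis unfolding ineq by auto
    qed
    have ub: "ub \<in> PiE {..<N} \<Omega>" using referenceD(2,5) by (auto simp: PiE_iff)
    have "0 \<le> p 0 (x0 - xb 0)" if "x0 \<in> C" for x0
      using *[OF that ub wb] Q0 R0 ws0 by linarith
    moreover have "0 \<le> ?Q u" if "u \<in> PiE {..<N} \<Omega>" for u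
      using *[OF referenceD(3) that wb] P0 R0 ws0 by linarith
    moreover have "ws j v = gw j v + p (Suc j) (T j v)" if j: "j < N" and v: "v \<in> W j" for j v
    proof -
      \<comment> \<open>Only component \<open>j\<close> of the parameter moves; applying \<open>le\<close> to \<open>v\<close> and \<open>- v\<close> gives equality.\<close>
      have le: "ws j v \<le> gw j v + p (Suc j) (T j v)" if v: "v \<in> W j" for v
      proof -
        let ?w = "wb(j := wb j + v)"
        have "?w \<in> PiE {..<N} W"
          using j v wb wbD W by (auto simp: PiE_iff extensional_def intro!: subspace_add)
        from *[OF referenceD(3) ub this] have "(\<Sum>k<N. ws k (?w k - wb k)) \<le> ?R ?w"
          using P0 Q0 by linarith
        moreover have "(\<Sum>k<N. ws k (?w k - wb k)) = (\<Sum>k<N. if k = j then ws j v else 0)"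
          by (intro sum.cong) (auto simp: cont_dual_zero[OF wsk W])
        moreover have "?R ?w = (\<Sum>k<N. if k = j then gw j v + p (Suc j) (T j v) else 0)"
          using zero by (intro sum.cong) (auto simp: L0[OF T W] cont_dual_zero[OF gw W])
        ultimately show ?thesis using j by simp
      qed
      have "- v \<in> W j" using W[OF j] v by (rule subspace_neg)
      moreover have "T j (- v) = - T j v"
        using linear_between_scale[OF T[OF j] v, of "-1"] by simp
      moreover have "p (Suc j) (- T j v) = - p (Suc j) (T j v)"
        using j v by (intro cont_dual_minus[OF p] linear_between_mem[OF T]) auto
      ultimately show ?thesis
        using le[OF v] le[of "- v"] cont_dual_minus[OF wsk[OF j] v] cont_dual_minus[OF gw[OF j] v]
        by simp
    qed
    ultimately show "?C \<and> ?U \<and> ?W" by blast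
  next
    assume R: "?C \<and> ?U \<and> ?W"
    show "ws \<in> tuple_subdifferential {..<N} W V wb"
      unfolding ineq
    proof (intro ballI allI impI)
      fix w x u assume w: "w \<in> PiE {..<N} W" and xu: "(x, u) \<in> F w"
      have "u \<in> PiE {..<N} \<Omega>" using feasibleD(2,5)[OF xu] by (auto simp: PiE_iff)
      moreover have "(\<Sum>k<N. ws k (w k - wb k)) = ?R w"
      proof (rule sum.cong)
        fix k assume "k \<in> {..<N}"
        then have "k < N" "w k - wb k \<in> W k"
          using w wbD W by (auto intro!: subspace_diff)
        then show "ws k (w k - wb k) = gw k (w k - wb k) + p (Suc k) (T k (w k - wb k))"
          using R by blast
      qed simp
      ultimately show "(\<Sum>k<N. ws k (w k - wb k)) \<le> p 0 (x 0 - xb 0) + ?Q u + ?R w"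
        using R feasibleD(3)[OF xu] by auto
    qed
  qed
qed

end

lemma backward_recursion:
  fixes N :: nat
  shows "\<exists>p. p N = a \<and> (\<forall>k<N. p k = G k (p (Suc k)))"
proof (induction N arbitrary: a)
  case (Suc N)
  obtain p where p: "p N = G N a" "\<forall>k<N. p k = G k (p (Suc k))" using Suc by blast
  then have "\<forall>k<Suc N. (p(Suc N := a)) k = G k ((p(Suc N := a)) (Suc k))"
    by (auto simp: less_Suc_eq)
  then show ?case by (intro exI[of _ "p(Suc N := a)"]) simp
qed auto

section \<open>The subdifferential of the optimal value function\<close>

theorem theorem4:
  fixes N :: nat
    and X :: "nat \<Rightarrow> 'x::banach set"
    and U :: "nat \<Rightarrow> 'u::banach set"
    and W :: "nat \<Rightarrow> 'w::banach set"
    and C :: "'x set"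
    and \<Omega> :: "nat \<Rightarrow> 'u set"
    and A :: "nat \<Rightarrow> 'x \<Rightarrow> 'x"
    and B :: "nat \<Rightarrow> 'u \<Rightarrow> 'x"
    and T :: "nat \<Rightarrow> 'w \<Rightarrow> 'x"
    and h :: "nat \<Rightarrow> 'x \<times> 'u \<times> 'w \<Rightarrow> real"
    and hN :: "'x \<Rightarrow> real"
    and xb :: "nat \<Rightarrow> 'x"
    and ub :: "nat \<Rightarrow> 'u"
    and wb :: "nat \<Rightarrow> 'w"
    and ws :: "nat \<Rightarrow> 'w \<Rightarrow> real"
  assumes N: "N \<ge> 1"
    and X: "\<forall>k\<le>N. banach_subspace (X k)"
    and U: "\<forall>k<N. banach_subspace (U k)"
    and W: "\<forall>k<N. banach_subspace (W k)"
    and C: "C \<subseteq> X 0" "convex C"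
    and Omega: "\<forall>k<N. \<Omega> k \<subseteq> U k \<and> convex (\<Omega> k)"
    and A: "\<forall>k<N. cont_linear_between (X k) (X (Suc k)) (A k)"
    and B: "\<forall>k<N. cont_linear_between (U k) (X (Suc k)) (B k)"
    and T: "\<forall>k<N. cont_linear_between (W k) (X (Suc k)) (T k)"
    and h_convex: "\<forall>k<N. convex_on (X k \<times> U k \<times> W k) (h k)"
    and hN_convex: "convex_on (X N) hN"
    and wb: "wb \<in> PiE {..<N} W"
    and V_finite: "\<bar>opt_value N X U C \<Omega> A B T h hN wb\<bar> \<noteq> \<infinity>"
    and sol: "(xb, ub) \<in> solutions N X U C \<Omega> A B T h hN wb"
    and h_cont: "\<forall>k<N. continuous_on (X k \<times> U k \<times> W k) (h k)"
    and hN_cont: "continuous_on (X N) hN"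
    and Omega_int: "\<forall>k<N. top_of_set (U k) interior_of \<Omega> k \<noteq> {}"
    and ker: "ker_adjoint {1..N} X (PiE {..<N} W) (T_op N T)
              \<subseteq> ker_adjoint {1..N} X (PiE {..N} X \<times> PiE {..<N} U) (M_op N A B)"
    and closed_range: "closedin (product_topology (\<lambda>k. top_of_set (X k)) {1..N})
              (Phi_op N A B T ` (PiE {..<N} W \<times> (PiE {..N} X \<times> PiE {..<N} U)))"
    and h_diff: "\<forall>k<N. frechet_differentiable_on (X k \<times> U k \<times> W k) (h k)"
    and hN_diff: "frechet_differentiable_on (X N) hN"
    and ws: "ws \<in> tuple_dual {..<N} W"
  shows "ws \<in> tuple_subdifferential {..<N} W (opt_value N X U C \<Omega> A B T h hN) wb \<longleftrightarrow>
    (\<exists>x0s \<in> normal_cone (X 0) C (xb 0).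
     \<exists>xs \<in> tuple_dual {1..N} X.
     \<exists>us \<in> tuple_normal_cone {..<N} U (PiE {..<N} \<Omega>) ub.
       (\<forall>v\<in>X N. xs N v = frechet_deriv_on (X N) hN (xb N) v) \<and>
       (\<forall>k\<in>{1..<N}. \<forall>v\<in>X k.
          xs k v = frechet_deriv_on (X k) (\<lambda>x. h k (x, ub k, wb k)) (xb k) v
                   + adjoint_on (X k) (A k) (xs (Suc k)) v) \<and>
       (\<forall>v\<in>X 0.
          x0s v = - frechet_deriv_on (X 0) (\<lambda>x. h 0 (x, ub 0, wb 0)) (xb 0) v
                  - adjoint_on (X 0) (A 0) (xs 1) v) \<and>
       (\<forall>k<N. \<forall>v\<in>U k.
          us k v = - frechet_deriv_on (U k) (\<lambda>u. h k (xb k, u, wb k)) (ub k) v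
                   - adjoint_on (U k) (B k) (xs (Suc k)) v) \<and>
       (\<forall>k<N. \<forall>v\<in>W k.
          ws k v = frechet_deriv_on (W k) (\<lambda>w. h k (xb k, ub k, w)) (wb k) v
                   + adjoint_on (W k) (T k) (xs (Suc k)) v))"
proof -
  let ?gx = "\<lambda>k. frechet_deriv_on (X k) (\<lambda>x. h k (x, ub k, wb k)) (xb k)"
  let ?gu = "\<lambda>k. frechet_deriv_on (U k) (\<lambda>u. h k (xb k, u, wb k)) (ub k)"
  let ?gw = "\<lambda>k. frechet_deriv_on (W k) (\<lambda>w. h k (xb k, ub k, w)) (wb k)"
  let ?gN = "frechet_deriv_on (X N) hN (xb N)"
  have sX: "subspace (X k)" if "k \<le> N" for k using X that by (simp add: banach_subspace_def)
  have sU: "subspace (U k)" if "k < N" for k using U that by (simp add: banach_subspace_def)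
  have sW: "subspace (W k)" if "k < N" for k using W that by (simp add: banach_subspace_def)
  have feas: "(xb, ub) \<in> feasible N X U C \<Omega> A B T wb" using sol by (simp add: solutions_def)
  have mx: "xb k \<in> X k" if "k \<le> N" for k using feas that by (auto simp: feasible_def)
  have mu: "ub k \<in> U k" if "k < N" for k using feas that by (auto simp: feasible_def)
  have mw: "wb k \<in> W k" if "k < N" for k using wb that by auto
  have gx: "?gx k \<in> cont_dual (X k)" and gu: "?gu k \<in> cont_dual (U k)"
    and gw: "?gw k \<in> cont_dual (W k)"
    and hk: "has_frechet_on (X k \<times> U k \<times> W k) (h k)
        (\<lambda>(a, b, c)\<in>X k \<times> U k \<times> W k. ?gx k a + ?gu k b + ?gw k c) (xb k, ub k, wb k)"
    if k: "k < N" for k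
    by (rule has_frechet_on_partials; use k h_diff sX sU sW mx mu mw in auto)+
  have hN: "has_frechet_on (X N) hN ?gN (xb N)"
    using hN_diff mx[of N] sX[of N] frechet_deriv_on_eqI[of "X N" "xb N" hN]
    unfolding frechet_differentiable_on_def by fastforce
  then have gN: "?gN \<in> cont_dual (X N)" by (simp add: has_frechet_on_def)
  have du: "u k - ub k \<in> U k" if "u \<in> PiE {..<N} \<Omega>" "k < N" for u k
    using that mu Omega sU by (intro subspace_diff) (auto simp: PiE_iff subset_iff)
  interpret process: differentiable_control_problem N X U W C \<Omega> A B T h hN xb ub wb ?gx ?gu ?gw ?gN
    using sX sU sW C Omega A B T h_convex hN_convex wb sol hk hN
    by unfold_locales (auto simp: cont_linear_between_def)
  show ?thesis (is "_ \<longleftrightarrow> ?E")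
  proof
    assume sub: "ws \<in> tuple_subdifferential {..<N} W (opt_value N X U C \<Omega> A B T h hN) wb"
    obtain p where pN: "p N = ?gN"
      and pk: "\<forall>k<N. p k = (\<lambda>v\<in>X k. ?gx k v + adjoint_on (X k) (A k) (p (Suc k)) v)"
      using backward_recursion[of N ?gN
          "\<lambda>k q. \<lambda>v\<in>X k. ?gx k v + adjoint_on (X k) (A k) q v"] by blast
    have p: "p k \<in> cont_dual (X k)" if "k \<le> N" for k
      using that
    proof (induction k rule: inc_induct)
      case base
      show ?case using pN gN by simp
    next
      case (step k)
      then have "adjoint_on (X k) (A k) (p (Suc k)) \<in> cont_dual (X k)"
        using A sX[of k] by (intro adjoint_on_cont_dual[of _ "X (Suc k)"]) auto
      then have "(\<lambda>v\<in>X k. ?gx k v + adjoint_on (X k) (A k) (p (Suc k)) v) \<in> cont_dual (X k)"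
        using step gx[of k] sX[of k] by (intro cont_dual_restrict_sum) auto
      then show ?case using pk step by metis
    qed
    have pk': "p k v = ?gx k v + p (Suc k) (A k v)" if "k < N" "v \<in> X k" for k v
      using pk that by (simp add: adjoint_on_def)
    have *: "\<forall>x0\<in>C. 0 \<le> p 0 (x0 - xb 0)"
      "\<forall>u\<in>PiE {..<N} \<Omega>. 0 \<le> (\<Sum>k<N. ?gu k (u k - ub k) + p (Suc k) (B k (u k - ub k)))"
      "\<forall>k<N. \<forall>v\<in>W k. ws k v = ?gw k v + p (Suc k) (T k v)"
      using process.subdifferential_iff_adjoint[OF p _ pk' gw gu ws] pN sub by auto
    define hu where "hu k = (\<lambda>v\<in>U k. ?gu k v + adjoint_on (U k) (B k) (p (Suc k)) v)" for k
    define us where "us = (\<lambda>k\<in>{..<N}. \<lambda>v\<in>U k. - hu k v)"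
    have "(\<lambda>v\<in>U k. - hu k v) \<in> cont_dual (U k)" if k: "k < N" for k
    proof -
      have "adjoint_on (U k) (B k) (p (Suc k)) \<in> cont_dual (U k)"
        using B k p by (intro adjoint_on_cont_dual[of _ "X (Suc k)"] sU) auto
      then have "hu k \<in> cont_dual (U k)"
        unfolding hu_def by (intro cont_dual_restrict_sum sU gu k)
      then show ?thesis by (intro cont_dual_restrict_uminus sU k)
    qed
    then have "us \<in> tuple_dual {..<N} U"
      unfolding us_def tuple_dual_def restrict_PiE_iff by blast
    moreover have "pairing {..<N} us (\<lambda>k\<in>{..<N}. u k - ub k) \<le> 0" if u: "u \<in> PiE {..<N} \<Omega>" for u
    proof -
      have "pairing {..<N} us (\<lambda>k\<in>{..<N}. u k - ub k)
          = (\<Sum>k<N. - (?gu k (u k - ub k) + p (Suc k) (B k (u k - ub k))))"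
        unfolding pairing_def by (intro sum.cong) (auto simp: us_def hu_def adjoint_on_def du[OF u])
      then show ?thesis using *(2) u by (simp add: sum_negf del: minus_add_distrib)
    qed
    ultimately have us: "us \<in> tuple_normal_cone {..<N} U (PiE {..<N} \<Omega>) ub"
      by (simp add: tuple_normal_cone_def)
    have x0: "(\<lambda>v\<in>X 0. - p 0 v) \<in> normal_cone (X 0) C (xb 0)"
      using *(1) cont_dual_restrict_uminus[OF sX[of 0] p[of 0]] C mx[of 0] sX[of 0]
      by (auto simp: normal_cone_def subspace_diff subset_iff)
    have xs: "restrict p {1..N} \<in> tuple_dual {1..N} X"
      using p by (auto simp: tuple_dual_def)
    show ?E
      by (rule bexI[OF _ x0], rule bexI[OF _ xs], rule bexI[OF _ us])
        (use N pN pk' * in \<open>auto simp: us_def hu_def adjoint_on_def\<close>)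
  next
    assume ?E
    then obtain x0s xs us where x0s: "x0s \<in> normal_cone (X 0) C (xb 0)"
      and xs: "xs \<in> tuple_dual {1..N} X"
      and us: "us \<in> tuple_normal_cone {..<N} U (PiE {..<N} \<Omega>) ub"
      and e1: "\<forall>v\<in>X N. xs N v = ?gN v"
      and e2: "\<forall>k\<in>{1..<N}. \<forall>v\<in>X k. xs k v = ?gx k v + adjoint_on (X k) (A k) (xs (Suc k)) v"
      and e3: "\<forall>v\<in>X 0. x0s v = - ?gx 0 v - adjoint_on (X 0) (A 0) (xs 1) v"
      and e4: "\<forall>k<N. \<forall>v\<in>U k. us k v = - ?gu k v - adjoint_on (U k) (B k) (xs (Suc k)) v"
      and e5: "\<forall>k<N. \<forall>v\<in>W k. ws k v = ?gw k v + adjoint_on (W k) (T k) (xs (Suc k)) v"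
      by blast
    \<comment> \<open>\<open>- x\<^sub>0\<^sup>*\<close> is the value of the adjoint state at \<open>0\<close>: it extends the recursion of \<open>xs\<close> to index \<open>0\<close>.\<close>
    define p where "p k = (if k = 0 then \<lambda>v\<in>X 0. - x0s v else xs k)" for k
    have p: "p k \<in> cont_dual (X k)" if "k \<le> N" for k
      using that x0s xs sX cont_dual_restrict_uminus
      by (auto simp: p_def normal_cone_def tuple_dual_def PiE_iff)
    have pN: "p N v = ?gN v" if "v \<in> X N" for v using e1 N that by (simp add: p_def)
    have pk: "p k v = ?gx k v + p (Suc k) (A k v)" if "k < N" "v \<in> X k" for k v
      using e2 e3 that by (cases k) (auto simp: p_def adjoint_on_def)
    have "0 \<le> p 0 (x0 - xb 0)" if "x0 \<in> C" for x0
    proof -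
      have "x0 - xb 0 \<in> X 0" using that C mx[of 0] sX[of 0] by (auto intro!: subspace_diff)
      then show ?thesis using x0s that by (auto simp: p_def normal_cone_def)
    qed
    moreover have "0 \<le> (\<Sum>k<N. ?gu k (u k - ub k) + p (Suc k) (B k (u k - ub k)))"
      if u: "u \<in> PiE {..<N} \<Omega>" for u
    proof -
      have "(\<Sum>k<N. us k (u k - ub k))
          = (\<Sum>k<N. - (?gu k (u k - ub k) + p (Suc k) (B k (u k - ub k))))"
        using e4 by (intro sum.cong) (auto simp: p_def adjoint_on_def du[OF u])
      moreover have "(\<Sum>k<N. us k (u k - ub k)) \<le> 0"
        using us u by (auto simp: tuple_normal_cone_def pairing_def)
      ultimately show ?thesis by (simp add: sum_negf del: minus_add_distrib)
    qed
    moreover have "ws k v = ?gw k v + p (Suc k) (T k v)" if "k < N" "v \<in> W k" for k v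
      using e5 that by (simp add: p_def adjoint_on_def)
    ultimately show "ws \<in> tuple_subdifferential {..<N} W (opt_value N X U C \<Omega> A B T h hN) wb"
      using process.subdifferential_iff_adjoint[OF p pN pk gw gu ws] by blast
  qed
qed

end
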